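(* Let $a,c>0$ and $b>1$ be such that $\ln c/\ln b\notin\mathbb{Q}$. Then the semigroup generated (under composition) by the maps $x\mapsto 1+\frac{a}{x}$, $x\mapsto\frac{x}{b}$ and $x\mapsto\frac{x}{c}$ is dense in $\mathcal{F}$.
   Context: $\mathcal{F}$ denotes the set of real linear fractional transformations $f(x)=\frac{\alpha x+\beta}{\gamma x+\delta}$ with $\alpha,\beta,\gamma,\delta\ge 0$ and $\alpha\delta-\beta\gamma\neq0$, regarded as maps of $(0,\infty)$ (the paper calls these the LFT's on $[0,\infty)$). Density is with respect to pointwise convergence: $f_i\to f$ if $f_i(x)\to f(x)$ for every $x>0$. *)

theory Defs
  imports Complex_Main "HOL-Library.FuncSet"
begin

text \<open>Maps of the open half line are represented as extensional functions on \<open>{0<..}\<close>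
  (value \<open>undefined\<close> elsewhere), so that they are equal iff they agree on the half line.\<close>

definition LFT :: "(real \<Rightarrow> real) set" where
  "LFT = {(\<lambda>x\<in>{0<..}. (\<alpha> * x + \<beta>) / (\<gamma> * x + \<delta>)) | \<alpha> \<beta> \<gamma> \<delta>.
            0 \<le> \<alpha> \<and> 0 \<le> \<beta> \<and> 0 \<le> \<gamma> \<and> 0 \<le> \<delta> \<and> \<alpha> * \<delta> - \<beta> * \<gamma> \<noteq> 0}"

text \<open>A semigroup, not a monoid: the identity is not included by default.\<close>

inductive_set semigroup_generated :: "'a set \<Rightarrow> ('a \<Rightarrow> 'a) set \<Rightarrow> ('a \<Rightarrow> 'a) set"
  for D :: "'a set" and G :: "('a \<Rightarrow> 'a) set" where
  generator: "g \<in> G \<Longrightarrow> g \<in> semigroup_generated D G"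
| composition: "f \<in> semigroup_generated D G \<Longrightarrow> g \<in> semigroup_generated D G \<Longrightarrow>
    compose D f g \<in> semigroup_generated D G"

definition converges_pointwise_on ::
    "'a set \<Rightarrow> (nat \<Rightarrow> 'a \<Rightarrow> 'b::topological_space) \<Rightarrow> ('a \<Rightarrow> 'b) \<Rightarrow> bool" where
  "converges_pointwise_on D s f \<longleftrightarrow> (\<forall>x\<in>D. (\<lambda>i. s i x) \<longlonglongrightarrow> f x)"

text \<open>Density is sequential, and a dense set is required to be a subset of the ambient set.\<close>

definition pointwise_dense_in ::
    "'a set \<Rightarrow> ('a \<Rightarrow> 'b::topological_space) set \<Rightarrow> ('a \<Rightarrow> 'b) set \<Rightarrow> bool" where
  "pointwise_dense_in D S F \<longleftrightarrow>
     S \<subseteq> F \<and> (\<forall>f\<in>F. \<exists>s. (\<forall>i. s i \<in> S) \<and> converges_pointwise_on D s f)"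

end

theory Submission
  imports Defs "HOL-Analysis.Kronecker_Approximation_Theorem"
begin

text \<open>
  Pass to nonnegative matrices and let \<open>C\<close> be the closure of the cone of matrices inducing elements
  of the semigroup; convergence of coefficients implies pointwise convergence, so it suffices that
  \<open>C\<close> contains every nonsingular nonnegative matrix.
  With \<open>F(x) = 1 + a / x\<close>,
  \<open>F (F (x / U) / S) / T = ((1 + a S) x + a U) / (T x + a T U)\<close>,
  which tends to the scaling \<open>x \<mapsto> \<rho> x\<close> as \<open>T, U \<rightarrow> \<infinity>\<close> and \<open>S / (T U) \<rightarrow> \<rho>\<close>.
  This makes multiplication by \<open>b\<close> and \<open>c\<close> available besides the given divisions, and irrationality
  of \<open>ln c / ln b\<close> yields all scalings by Kronecker's theorem.  Rescaling \<open>F\<close> and passing to the limit produces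
  \<open>x \<mapsto> r + s / x\<close> for \<open>r \<ge> 0\<close> and \<open>s > 0\<close>, and every map in question is a composition of these.
\<close>

section \<open>Matrices\<close>

text \<open>Entries are listed row by row; the product type supplies the topology and the scalar
  multiplication for limits of matrices.\<close>

type_synonym mat2 = "real \<times> real \<times> real \<times> real"

definition mat_mul :: "mat2 \<Rightarrow> mat2 \<Rightarrow> mat2" where
  "mat_mul = (\<lambda>(p, q, r, s) (p', q', r', s').
     (p * p' + q * r', p * q' + q * s', r * p' + s * r', r * q' + s * s'))"

definition mat_map :: "mat2 \<Rightarrow> real \<Rightarrow> real" where
  "mat_map = (\<lambda>(p, q, r, s). \<lambda>x\<in>{0<..}. (p * x + q) / (r * x + s))"

definition nonneg_nonsing :: "mat2 set" where
  "nonneg_nonsing = {(p, q, r, s). 0 \<le> p \<and> 0 \<le> q \<and> 0 \<le> r \<and> 0 \<le> s \<and> p * s - q * r \<noteq> 0}"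

lemma mat_mul_simp [simp]:
  "mat_mul (p, q, r, s) (p', q', r', s') =
     (p * p' + q * r', p * q' + q * s', r * p' + s * r', r * q' + s * s')"
  by (simp add: mat_mul_def)

lemma LFT_eq_mat_map_image: "LFT = mat_map ` nonneg_nonsing"
  unfolding LFT_def mat_map_def nonneg_nonsing_def by (auto simp: image_iff) blast+

lemma linear_form_pos:
  fixes p q x :: real
  assumes "0 \<le> p" "0 \<le> q" "p \<noteq> 0 \<or> q \<noteq> 0" "0 < x"
  shows "0 < p * x + q"
  using assms by (metis add_nonneg_pos add_pos_nonneg less_eq_real_def mult_nonneg_nonneg mult_pos_pos)

lemma nonneg_nonsing_forms_pos:
  assumes "(p, q, r, s) \<in> nonneg_nonsing" "0 < x"
  shows "0 < p * x + q" "0 < r * x + s"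
  using assms by (auto simp: nonneg_nonsing_def intro!: linear_form_pos)

lemma mat_mul_nonneg_nonsing:
  assumes "M \<in> nonneg_nonsing" "N \<in> nonneg_nonsing"
  shows "mat_mul M N \<in> nonneg_nonsing"
proof -
  obtain p q r s p' q' r' s' where M: "M = (p, q, r, s)" and N: "N = (p', q', r', s')"
    by (metis prod_cases4)
  have "(p * p' + q * r') * (r * q' + s * s') - (p * q' + q * s') * (r * p' + s * r')
        = (p * s - q * r) * (p' * s' - q' * r')"
    by algebra
  then show ?thesis
    using assms by (auto simp: M N nonneg_nonsing_def)
qed

lemma compose_mat_map:
  assumes "M \<in> nonneg_nonsing" "N \<in> nonneg_nonsing"
  shows "compose {0<..} (mat_map M) (mat_map N) = mat_map (mat_mul M N)"
proof
  fix x :: real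
  obtain p q r s p' q' r' s' where M: "M = (p, q, r, s)" and N: "N = (p', q', r', s')"
    by (metis prod_cases4)
  show "compose {0<..} (mat_map M) (mat_map N) x = mat_map (mat_mul M N) x"
  proof (cases "x > 0")
    case True
    define u v where "u = p' * x + q'" and "v = r' * x + s'"
    have pos: "u > 0" "v > 0"
      using nonneg_nonsing_forms_pos assms(2) True unfolding N u_def v_def by blast+
    have "(p * (u / v) + q) / (r * (u / v) + s) = (p * u + q * v) / (r * u + s * v)"
    proof -
      have "p * (u / v) + q = (p * u + q * v) / v" "r * (u / v) + s = (r * u + s * v) / v"
        using pos by (simp_all add: field_simps)
      then show ?thesis
        using pos by simp
    qed
    moreover have "p * u + q * v = (p * p' + q * r') * x + (p * q' + q * s')"
      "r * u + s * v = (r * p' + s * r') * x + (r * q' + s * s')"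
      by (simp_all add: u_def v_def algebra_simps)
    ultimately show ?thesis
      using True pos by (simp add: M N compose_def mat_map_def u_def v_def)
  qed (simp add: compose_def mat_map_def M N)
qed

text \<open>A matrix matters only up to a nonzero factor, which permits normalising it before taking
  a limit.\<close>

lemma mat_map_scaleR: "t \<noteq> 0 \<Longrightarrow> mat_map (t *\<^sub>R M) = mat_map M"
proof -
  assume "t \<noteq> 0"
  obtain p q r s where M: "M = (p, q, r, s)"
    by (metis prod_cases4)
  have "(t * p * x + t * q) / (t * r * x + t * s) = (p * x + q) / (r * x + s)" for x
    using \<open>t \<noteq> 0\<close> by (simp add: mult.assoc flip: distrib_left)
  then show ?thesis
    by (simp add: M mat_map_def fun_eq_iff restrict_def)
qed

lemma scaleR_nonneg_nonsing:
  assumes "t > 0" "M \<in> nonneg_nonsing" shows "t *\<^sub>R M \<in> nonneg_nonsing"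
proof -
  obtain p q r s where M: "M = (p, q, r, s)"
    by (metis prod_cases4)
  have "t * p * (t * s) - t * q * (t * r) = t\<^sup>2 * (p * s - q * r)"
    by (simp add: power2_eq_square algebra_simps)
  then show ?thesis
    using assms by (auto simp: M nonneg_nonsing_def)
qed

text \<open>Nonsingularity of the limit \<open>M\<close> makes its denominator positive at
  \<open>x\<close>, so the quotient of the limits exists.\<close>

lemma tendsto_mat_map:
  assumes "X \<longlonglongrightarrow> M" "M \<in> nonneg_nonsing" "x > 0"
  shows "(\<lambda>n. mat_map (X n) x) \<longlonglongrightarrow> mat_map M x"
proof -
  obtain p q r s where M: "M = (p, q, r, s)"
    by (metis prod_cases4)
  have "(\<lambda>n. (fst (X n) * x + fst (snd (X n))) / (fst (snd (snd (X n))) * x + snd (snd (snd (X n)))))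
        \<longlonglongrightarrow> (fst M * x + fst (snd M)) / (fst (snd (snd M)) * x + snd (snd (snd M)))"
    using nonneg_nonsing_forms_pos(2)[of p q r s x] assms
    by (intro tendsto_intros) (auto simp: M)
  then show ?thesis
    using assms(3) by (simp add: mat_map_def case_prod_beta)
qed

lemma continuous_on_mat_mul: "continuous_on A (\<lambda>z. mat_mul (fst z) (snd z))"
  unfolding mat_mul_def case_prod_beta by (intro continuous_intros)

section \<open>Multiplicative density\<close>

text \<open>In logarithms to base \<open>b\<close>, the products \<open>c^k * b^(-h)\<close> become
  \<open>k * (ln c / ln b) - h\<close>; by Kronecker's theorem these numbers are dense, and
  closedness of \<open>D\<close> finishes.\<close>

lemma closed_mult_set_contains_pos:
  fixes D :: "real set"
  assumes D: "closed D" "\<And>x y. x \<in> D \<Longrightarrow> y \<in> D \<Longrightarrow> x * y \<in> D"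
    and gens: "b \<in> D" "inverse b \<in> D" "c \<in> D" "inverse c \<in> D"
    and bc: "b > 1" "c > 0" "ln c / ln b \<notin> \<rat>" and "\<rho> > 0"
  shows "\<rho> \<in> D"
proof -
  have one: "1 \<in> D"
    using D(2)[OF gens(1,2)] bc by simp
  have pow: "x ^ n \<in> D" if "x \<in> D" for x n
    by (induction n) (auto intro: one D(2) that)
  have powi: "b powi i \<in> D" "c powi i \<in> D" for i
    using gens pow by (auto simp: power_int_def)
  have lnb: "ln b > 0"
    using bc by simp
  have "\<exists>h k. \<bar>of_int k * (ln c / ln b) - of_int h - ln \<rho> / ln b\<bar> < inverse (Suc n)" for n
    using sequence_of_fractional_parts_is_dense[OF bc(3), of "inverse (Suc n)" "ln \<rho> / ln b"]
    by (metis inverse_positive_iff_positive of_nat_0_less_iff zero_less_Suc)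
  then obtain h k :: "nat \<Rightarrow> int"
    where hk: "\<And>n. \<bar>of_int (k n) * (ln c / ln b) - of_int (h n) - ln \<rho> / ln b\<bar> < inverse (Suc n)"
    by metis
  have "(\<lambda>n. of_int (k n) * (ln c / ln b) - of_int (h n) - ln \<rho> / ln b) \<longlonglongrightarrow> 0"
    by (rule Lim_null_comparison[OF _ LIMSEQ_inverse_real_of_nat])
      (use hk in \<open>auto intro!: always_eventually less_imp_le\<close>)
  \<comment> \<open>Undo the logarithm: the error, multiplied by \<open>ln b\<close> and shifted by
    \<open>ln \<rho>\<close>, is the logarithm of a product of powers of \<open>c\<close> and
    \<open>b\<close>.\<close>
  then have "(\<lambda>n. exp (ln b * (of_int (k n) * (ln c / ln b) - of_int (h n) - ln \<rho> / ln b) + ln \<rho>))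
      \<longlonglongrightarrow> exp (ln b * 0 + ln \<rho>)"
    by (intro tendsto_intros)
  moreover have "exp (ln b * (of_int (k n) * (ln c / ln b) - of_int (h n) - ln \<rho> / ln b) + ln \<rho>)
      = c powi k n * b powi (- h n)" for n
  proof -
    have "ln b * (of_int (k n) * (ln c / ln b) - of_int (h n) - ln \<rho> / ln b) + ln \<rho>
        = of_int (k n) * ln c + of_int (- h n) * ln b"
      using lnb by (simp add: field_simps)
    moreover have "exp (of_int i * ln x) = x powi i" if "x > 0" for i and x :: real
      using that by (metis exp_power_int exp_ln mult.commute)
    ultimately show ?thesis
      using bc by (simp only: exp_add)
  qed
  ultimately have "(\<lambda>n. c powi k n * b powi (- h n)) \<longlonglongrightarrow> \<rho>"
    using \<open>\<rho> > 0\<close> by simp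
  then show ?thesis
    by (rule closed_sequentially[OF D(1), rotated]) (intro D(2) powi)
qed

section \<open>Closed matrix cones\<close>

text \<open>An abstraction of the closure of the matrices inducing semigroup elements;
  \<open>C\<close> may contain singular limits.\<close>

locale closed_mat_cone =
  fixes a b c :: real and C :: "mat2 set"
  assumes closed_C: "closed C"
    and mul_C: "M \<in> C \<Longrightarrow> N \<in> C \<Longrightarrow> mat_mul M N \<in> C"
    and scale_C: "t > 0 \<Longrightarrow> M \<in> C \<Longrightarrow> t *\<^sub>R M \<in> C"
    and F_C: "(1, a, 1, 0) \<in> C"
    and b_C: "(1, 0, 0, b) \<in> C"
    and c_C: "(1, 0, 0, c) \<in> C"
    and a_pos: "a > 0" and b_gt_1: "b > 1" and c_pos: "c > 0"
    and irrational: "ln c / ln b \<notin> \<rat>"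
begin

lemma limit_C: "X \<longlonglongrightarrow> M \<Longrightarrow> (\<And>n. X n \<in> C) \<Longrightarrow> M \<in> C"
  using closed_C closed_sequentially by blast

lemma dilation_limit_C:
  assumes C: "\<And>n. (1, 0, 0, S n) \<in> C" "\<And>n. (1, 0, 0, T n) \<in> C" "\<And>n. (1, 0, 0, U n) \<in> C"
    and pos: "\<And>n. T n > 0" "\<And>n. U n > 0"
    and lim: "filterlim T at_top sequentially" "filterlim U at_top sequentially"
      "(\<lambda>n. S n / (T n * U n)) \<longlonglongrightarrow> \<rho>"
  shows "(\<rho>, 0, 0, 1) \<in> C"
proof (rule limit_C)
  let ?F = "(1, a, 1, 0)"
  let ?X = "\<lambda>n. (inverse a * (inverse (T n) * inverse (U n)) + S n / (T n * U n), inverse (T n),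
                 inverse a * inverse (U n), 1)"
  have inv: "(\<lambda>n. inverse (T n)) \<longlonglongrightarrow> 0" "(\<lambda>n. inverse (U n)) \<longlonglongrightarrow> 0"
    using lim tendsto_inverse_0_at_top by blast+
  have "?X \<longlonglongrightarrow> (inverse a * (0 * 0) + \<rho>, 0, inverse a * 0, 1)"
    by (intro tendsto_intros inv lim)
  then show "?X \<longlonglongrightarrow> (\<rho>, 0, 0, 1)"
    by simp
  fix n
  \<comment> \<open>The matrix of \<open>F (F (x / U) / S) / T\<close>, divided by its lower right
    entry \<open>a * T * U\<close> so that the entries converge.\<close>
  have "(1 / (a * T n * U n)) *\<^sub>R mat_mul (1, 0, 0, T n) (mat_mul ?F (mat_mul (1, 0, 0, S n)
          (mat_mul ?F (1, 0, 0, U n)))) \<in> C"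
    using a_pos pos by (intro scale_C mul_C F_C C) auto
  also have "(1 / (a * T n * U n)) *\<^sub>R mat_mul (1, 0, 0, T n) (mat_mul ?F (mat_mul (1, 0, 0, S n)
          (mat_mul ?F (1, 0, 0, U n)))) = ?X n"
    using a_pos pos[of n] by (simp add: field_simps)
  finally show "?X n \<in> C" .
qed

text \<open>Exponents start at 1 because the identity matrix is not assumed to lie in
  \<open>C\<close>.\<close>

lemma power_C: "(1, 0, 0, x) \<in> C \<Longrightarrow> (1, 0, 0, x ^ Suc n) \<in> C"
proof (induction n)
  case (Suc n)
  then show ?case
    using mul_C[of "(1, 0, 0, x)" "(1, 0, 0, x ^ Suc n)"] by simp
qed simp

lemma diag_inverse_C: "x > 0 \<Longrightarrow> (1, 0, 0, x) \<in> C \<Longrightarrow> (inverse x, 0, 0, 1) \<in> C"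
  using scale_C[of "inverse x" "(1, 0, 0, x)"] by simp

text \<open>Turns division by \<open>w\<close> into multiplication by \<open>w\<close>: with
  \<open>T = U = b^(n+1)\<close> and \<open>S = T * U * w\<close>, the ratio
  \<open>S / (T * U)\<close> is constantly \<open>w\<close>.\<close>

lemma diag_swap_C:
  assumes "w > 0" "(1, 0, 0, w) \<in> C"
  shows "(w, 0, 0, 1) \<in> C"
proof (rule dilation_limit_C)
  let ?P = "\<lambda>n. b ^ Suc n"
  show "(1, 0, 0, ?P n * ?P n * w) \<in> C" for n
    using mul_C[OF mul_C[OF power_C[OF b_C] power_C[OF b_C]] assms(2), of n n] by simp
  show "filterlim ?P at_top sequentially" "filterlim ?P at_top sequentially"
    using filterlim_realpow_sequentially_gt1[of b] b_gt_1
    by (simp_all only: filterlim_sequentially_Suc)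
      (simp_all add: filterlim_at_infinity_imp_filterlim_at_top)
  show "(\<lambda>n. ?P n * ?P n * w / (?P n * ?P n)) \<longlonglongrightarrow> w"
    using b_gt_1 by simp
qed (use b_gt_1 power_C[OF b_C] in auto)

lemma scaling_C:
  assumes "\<rho> > 0"
  shows "(\<rho>, 0, 0, 1) \<in> C"
proof -
  let ?D = "(\<lambda>r. (r, 0, 0, 1)) -` C"
  have "closed ?D"
    by (intro closed_vimage closed_C continuous_intros)
  moreover have "x * y \<in> ?D" if "x \<in> ?D" "y \<in> ?D" for x y
    using that mul_C[of "(x, 0, 0, 1)" "(y, 0, 0, 1)"] by simp
  \<comment> \<open>The inverses are the given divisions after normalisation; \<open>b\<close> and
    \<open>c\<close> themselves come from \<open>diag_swap_C\<close>.\<close>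
  moreover have "b \<in> ?D" "inverse b \<in> ?D" "c \<in> ?D" "inverse c \<in> ?D"
    using diag_swap_C diag_inverse_C b_C c_C b_gt_1 c_pos by auto
  ultimately have "\<rho> \<in> ?D"
    using closed_mult_set_contains_pos b_gt_1 c_pos irrational assms by blast
  then show ?thesis
    by simp
qed

text \<open>Scaling before and after \<open>F\<close>:
  \<open>r * (1 + a / (r * a * x / s)) = r + s / x\<close>. The factor \<open>s / (r * a)\<close>
  only adjusts the representing matrix.\<close>

lemma shifted_inversion_C_pos:
  assumes "r > 0" "s > 0"
  shows "(r, s, 1, 0) \<in> C"
proof -
  have "mat_mul (r, 0, 0, 1) (mat_mul (1, a, 1, 0) ((s / (r * a)) *\<^sub>R (r * a / s, 0, 0, 1))) \<in> C"
    using assms a_pos by (intro mul_C scale_C scaling_C F_C) auto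
  then show ?thesis
    using assms a_pos by simp
qed

text \<open>The case \<open>r = 0\<close>, \<open>s = 1\<close>, reached as a limit of positive
  shifts \<open>r\<close>.\<close>

lemma inversion_C: "(0, 1, 1, 0) \<in> C"
proof (rule limit_C)
  show "(\<lambda>n. (inverse (real (Suc n)), 1 :: real, 1 :: real, 0 :: real)) \<longlonglongrightarrow> (0, 1, 1, 0)"
    by (intro tendsto_intros LIMSEQ_inverse_real_of_nat)
qed (auto intro: shifted_inversion_C_pos)

text \<open>For \<open>r > 0\<close>, apply \<open>x \<mapsto> r + s / x\<close> after the
  inversion.\<close>

lemma affine_C:
  assumes "s > 0" "r \<ge> 0"
  shows "(s, r, 0, 1) \<in> C"
proof (cases "r = 0")
  case True
  then show ?thesis
    using scaling_C assms by simp
next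
  case False
  then show ?thesis
    using mul_C[OF shifted_inversion_C_pos inversion_C, of r s] assms by simp
qed

text \<open>Division with remainder: \<open>(p * x + q) / (r * x + s) = p / r + ((q * r - p * s) /
  r) / (r * x + s)\<close>. The negative determinant forces \<open>r > 0\<close> and makes the
  coefficient of the last fraction positive.\<close>

lemma neg_det_C:
  assumes "0 \<le> p" "0 \<le> q" "0 \<le> r" "0 \<le> s" "p * s < q * r"
  shows "(p, q, r, s) \<in> C"
proof -
  have r: "r > 0"
    using assms by (metis less_eq_real_def linorder_not_less mult_nonneg_nonneg mult_zero_right)
  have "mat_mul (mat_mul ((q * r - p * s) / r, p / r, 0, 1) (0, 1, 1, 0)) (r, s, 0, 1) \<in> C"
    using assms r by (intro mul_C affine_C inversion_C) auto
  then show ?thesis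
    using r by (simp add: field_simps)
qed

lemma nonneg_nonsing_subset_C: "nonneg_nonsing \<subseteq> C"
proof clarify
  fix p q r s
  assume "(p, q, r, s) \<in> nonneg_nonsing"
  then have nn: "0 \<le> p" "0 \<le> q" "0 \<le> r" "0 \<le> s" and "p * s \<noteq> q * r"
    by (auto simp: nonneg_nonsing_def)
  then consider "p * s < q * r" | "r * q < s * p"
    by (metis linorder_neqE mult.commute)
  then show "(p, q, r, s) \<in> C"
  proof cases
    case 1
    then show ?thesis
      using neg_det_C nn by blast
  next
    case 2
    then show ?thesis
      \<comment> \<open>Multiplying by the inversion on the left swaps the rows and so flips the
        sign of the determinant.\<close>
      using mul_C[OF inversion_C neg_det_C[of r s p q]] nn by simp
  qed
qed

end

section \<open>The generated semigroup\<close>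

theorem theorem2p4:
  fixes a b c :: real
  assumes "a > 0" and "c > 0" and "b > 1"
    and "ln c / ln b \<notin> \<rat>"
  shows "pointwise_dense_in {0<..}
           (semigroup_generated {0<..}
              {(\<lambda>x\<in>{0<..}. 1 + a / x), (\<lambda>x\<in>{0<..}. x / b), (\<lambda>x\<in>{0<..}. x / c)})
           LFT"
proof -
  let ?G = "{(\<lambda>x\<in>{0<..}. 1 + a / x), (\<lambda>x\<in>{0<..}. x / b), (\<lambda>x\<in>{0<..}. x / c)}"
  let ?S = "semigroup_generated {0<..} ?G"
  define T where "T = {M \<in> nonneg_nonsing. mat_map M \<in> ?S}"
  have gen_mats: "(1, a, 1, 0) \<in> nonneg_nonsing" "(1, 0, 0, b) \<in> nonneg_nonsing"
      "(1, 0, 0, c) \<in> nonneg_nonsing"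
    using assms by (auto simp: nonneg_nonsing_def)
  have gens: "mat_map (1, a, 1, 0) = (\<lambda>x\<in>{0<..}. 1 + a / x)"
    "mat_map (1, 0, 0, b) = (\<lambda>x\<in>{0<..}. x / b)" "mat_map (1, 0, 0, c) = (\<lambda>x\<in>{0<..}. x / c)"
    by (auto simp: mat_map_def fun_eq_iff restrict_def field_simps)
  have "f \<in> LFT" if "f \<in> ?S" for f
    using that
  proof induction
    case (generator g)
    then have "g \<in> mat_map ` {(1, a, 1, 0), (1, 0, 0, b), (1, 0, 0, c)}"
      by (auto simp: gens)
    then show ?case
      unfolding LFT_eq_mat_map_image using gen_mats by blast
  next
    case (composition f g)
    then obtain M N where "M \<in> nonneg_nonsing" "N \<in> nonneg_nonsing" "f = mat_map M" "g = mat_map N"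
      unfolding LFT_eq_mat_map_image by blast
    then show ?case
      unfolding LFT_eq_mat_map_image
      using compose_mat_map mat_mul_nonneg_nonsing by blast
  qed
  moreover have "\<exists>s. (\<forall>i. s i \<in> ?S) \<and> converges_pointwise_on {0<..} s f" if "f \<in> LFT" for f
  proof -
    interpret closed_mat_cone a b c "closure T"
    proof
      have "mat_mul M N \<in> T" if "M \<in> T" "N \<in> T" for M N
        using that
        by (auto simp: T_def mat_mul_nonneg_nonsing semigroup_generated.composition
            simp flip: compose_mat_map)
      then have "(\<lambda>z. mat_mul (fst z) (snd z)) ` (T \<times> T) \<subseteq> T"
        by (simp add: image_subset_iff del: split_paired_All)
      \<comment> \<open>Continuity of the product carries closure under multiplication from
        \<open>T\<close> to \<open>closure T\<close>.\<close>
      then have "(\<lambda>z. mat_mul (fst z) (snd z)) ` closure (T \<times> T) \<subseteq> closure T"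
        by (intro image_closure_subset continuous_on_mat_mul closed_closure
            subset_trans[OF _ closure_subset])
      then show "mat_mul M N \<in> closure T" if "M \<in> closure T" "N \<in> closure T" for M N
        using that by (force simp: closure_Times simp del: mat_mul_simp)
      show "t *\<^sub>R M \<in> closure T" if "t > 0" "M \<in> closure T" for t M
      proof -
        have "(*\<^sub>R) t ` T \<subseteq> T"
          using \<open>t > 0\<close> mat_map_scaleR scaleR_nonneg_nonsing
          by (simp add: T_def image_subset_iff del: scaleR_Pair split_paired_All)
        then have "(*\<^sub>R) t ` closure T \<subseteq> closure T"
          by (simp add: closure_scaleR closure_mono)
        then show ?thesis
          using that by blast
      qed
      show "(1, a, 1, 0) \<in> closure T" "(1, 0, 0, b) \<in> closure T" "(1, 0, 0, c) \<in> closure T"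
        using gen_mats
        by (auto simp: T_def gens intro!: closure_subset[THEN subsetD] semigroup_generated.generator)
    qed (use assms in auto)
    obtain M where M: "M \<in> nonneg_nonsing" "f = mat_map M"
      using \<open>f \<in> LFT\<close> by (auto simp: LFT_eq_mat_map_image)
    \<comment> \<open>The approximants are taken in \<open>T\<close> itself, so each induces an
      element of the semigroup, and coefficientwise convergence to the nonsingular \<open>M\<close>
      gives pointwise convergence.\<close>
    then obtain X where X: "\<And>n. X n \<in> T" "X \<longlonglongrightarrow> M"
      using nonneg_nonsing_subset_C closure_sequential by blast
    show ?thesis
    proof (intro exI conjI allI)
      show "mat_map (X n) \<in> ?S" for n
        using X(1) by (simp add: T_def)
      show "converges_pointwise_on {0<..} (\<lambda>n. mat_map (X n)) f"
        unfolding converges_pointwise_on_def M(2) using tendsto_mat_map[OF X(2) M(1)] by simp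
    qed
  qed
  ultimately show ?thesis
    unfolding pointwise_dense_in_def by blast
qed

end
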